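(* Let $d\geq 3$ be odd, and let Alice and Bob hold systems $A$ and $B$, each with Hilbert space $\mathbb{C}^d$ and standard orthonormal basis $|0\rangle,\dots,|d-1\rangle$. Let $\mathcal{U}_d\subset\mathbb{C}^d\otimes\mathbb{C}^d$ be the set of $(d-1)^2+1$ mutually orthogonal (unnormalized) product states consisting of, for each $t=0,1,\dots,\frac{d-3}{2}$ and each $k=1,\dots,d-2-2t$, with $\omega_t=e^{2\pi i/(d-1-2t)}$, the four states $$|t\rangle\otimes\sum_{j=t}^{d-2-t}\omega_t^{jk}|j\rangle,\qquad \Big(\sum_{j=t}^{d-2-t}\omega_t^{jk}|j\rangle\Big)\otimes|d-1-t\rangle,$$ $$|d-1-t\rangle\otimes\sum_{j=t+1}^{d-1-t}\omega_t^{jk}|j\rangle,\qquad \Big(\sum_{j=t+1}^{d-1-t}\omega_t^{jk}|j\rangle\Big)\otimes|t\rangle,$$ together with the stopper state $|F\rangle=\Big(\sum_{j=0}^{d-1}|j\rangle\Big)\otimes\Big(\sum_{j=0}^{d-1}|j\rangle\Big)$. Then the states of $\mathcal{U}_d$ can be perfectly distinguished by LOCC with the assistance of one $\frac{d+1}{2}\otimes\frac{d+1}{2}$ maximally entangled state shared between Alice and Bob.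
   Context: The first tensor factor belongs to Alice, the second to Bob; $i=\sqrt{-1}$ in the definition of $\omega_t$; normalization constants and global phases are ignored. A $q\otimes q$ maximally entangled state is the state (proportional to) $|\Psi\rangle_{ab}=\sum_{l=0}^{q-1}|l\rangle_a|l\rangle_b\in\mathbb{C}^q\otimes\mathbb{C}^q$, with ancillary system $a$ held by Alice and $b$ held by Bob. LOCC (local operations and classical communication): a protocol consists of finitely many rounds; in each round one of the parties performs a quantum measurement (Kraus operators $\{M_x\}$ with $\sum_x M_x^\dagger M_x=I$) acting only on that party's own systems, the choice of the measurement being allowed to depend on all previous outcomes, and the outcome is communicated to the other party. A finite set $S$ of pairwise orthogonal states of $AB$ is perfectly distinguished by LOCC with the assistance of a shared entangled state $|\Psi\rangle_{ab}$ if there is an LOCC protocol, in which Alice acts on $aA$ and Bob acts on $bB$, such that when it is applied to $|\phi\rangle_{AB}\otimes|\Psi\rangle_{ab}$ with $|\phi\rangle\in S$ unknown, the sequence of measurement outcomes determines $|\phi\rangle$ with certainty; i.e. for every complete sequence of outcomes, at most one $|\phi\rangle\in S$ gives it nonzero probability. *)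

theory Defs
  imports Complex_Main "Jordan_Normal_Form.Schur_Decomposition"
begin

section \<open>Tensor products\<close>

definition tensor_vec :: "complex vec \<Rightarrow> complex vec \<Rightarrow> complex vec" (infixl "\<otimes>v" 70) where
  "u \<otimes>v v = vec (dim_vec u * dim_vec v) (\<lambda>i. u $ (i div dim_vec v) * v $ (i mod dim_vec v))"

definition tensor_mat :: "complex mat \<Rightarrow> complex mat \<Rightarrow> complex mat" (infixl "\<otimes>m" 70) where
  "M \<otimes>m N = mat (dim_row M * dim_row N) (dim_col M * dim_col N)
     (\<lambda>(i, j). M $$ (i div dim_row N, j div dim_col N) * N $$ (i mod dim_row N, j mod dim_col N))"

section \<open>LOCC protocols\<close>

datatype party = Alice | Bob

text \<open>In \<open>Measure p r M C\<close> party \<open>p\<close> performs a measurement with outcomes \<open>0, \<dots>, r - 1\<close> and Kraus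
  operators \<open>M 0, \<dots>, M (r - 1)\<close>, and the protocol continues with \<open>C x\<close> after outcome \<open>x\<close>.  Everything
  that follows may thus depend on all previous outcomes.  The values of \<open>M\<close> and \<open>C\<close> at arguments
  \<open>\<ge> r\<close> are irrelevant; the tree of outcomes \<open>< r\<close> is well-founded and finitely branching, so the
  number of rounds is bounded.\<close>

datatype protocol = Stop | Measure party nat "nat \<Rightarrow> complex mat" "nat \<Rightarrow> protocol"

definition kraus_family :: "nat \<Rightarrow> nat \<Rightarrow> (nat \<Rightarrow> complex mat) \<Rightarrow> bool" where
  "kraus_family n r M \<longleftrightarrow> (\<forall>x<r. M x \<in> carrier_mat n n) \<and>
     mat n n (\<lambda>(i, j). \<Sum>x<r. (mat_adjoint (M x) * M x) $$ (i, j)) = 1\<^sub>m n"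

text \<open>Throughout, \<open>m\<close> and \<open>n\<close> are the dimensions of everything held by Alice and by Bob, respectively.\<close>

primrec valid_protocol :: "nat \<Rightarrow> nat \<Rightarrow> protocol \<Rightarrow> bool" where
  "valid_protocol m n Stop \<longleftrightarrow> True"
| "valid_protocol m n (Measure p r M C) \<longleftrightarrow>
     kraus_family (case p of Alice \<Rightarrow> m | Bob \<Rightarrow> n) r M \<and> (\<forall>x<r. valid_protocol m n (C x))"

primrec outcome_seqs :: "protocol \<Rightarrow> nat list set" where
  "outcome_seqs Stop = {[]}"
| "outcome_seqs (Measure p r M C) = (\<Union>x<r. (\<lambda>xs. x # xs) ` outcome_seqs (C x))"

definition local_op :: "nat \<Rightarrow> nat \<Rightarrow> party \<Rightarrow> complex mat \<Rightarrow> complex mat" where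
  "local_op m n p M = (case p of Alice \<Rightarrow> M \<otimes>m 1\<^sub>m n | Bob \<Rightarrow> 1\<^sub>m m \<otimes>m M)"

text \<open>The state after a complete sequence of outcomes, not renormalized.\<close>

primrec post_state :: "nat \<Rightarrow> nat \<Rightarrow> protocol \<Rightarrow> nat list \<Rightarrow> complex vec \<Rightarrow> complex vec" where
  "post_state m n Stop xs \<psi> = \<psi>"
| "post_state m n (Measure p r M C) xs \<psi> =
     post_state m n (C (hd xs)) (tl xs) (local_op m n p (M (hd xs)) *\<^sub>v \<psi>)"

text \<open>The denominator makes this the Born probability for unnormalized \<open>\<psi> \<noteq> 0\<close> as well.\<close>

definition outcome_prob :: "nat \<Rightarrow> nat \<Rightarrow> protocol \<Rightarrow> complex vec \<Rightarrow> nat list \<Rightarrow> real" where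
  "outcome_prob m n P \<psi> xs =
     Re (post_state m n P xs \<psi> \<bullet>c post_state m n P xs \<psi>) / Re (\<psi> \<bullet>c \<psi>)"

section \<open>Discrimination with shared entanglement\<close>

definition max_entangled :: "nat \<Rightarrow> complex vec" where
  "max_entangled q = vec (q * q) (\<lambda>i. if i div q = i mod q then 1 else 0)"

text \<open>The state \<open>\<phi>\<^sub>A\<^sub>B \<otimes> \<Psi>\<^sub>a\<^sub>b\<close> with its factors arranged in the order \<open>a, A, b, B\<close>, so that it is a
  state of \<open>(aA)(bB)\<close>; the dimensions of \<open>a, b\<close> and \<open>A, B\<close> are \<open>q\<close> and \<open>d\<close>.  Compare
  \<open>assisted_tensor_vec\<close> below.\<close>

definition assisted :: "nat \<Rightarrow> nat \<Rightarrow> complex vec \<Rightarrow> complex vec \<Rightarrow> complex vec" where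
  "assisted q d \<phi> \<Psi> = vec ((q * d) * (q * d)) (\<lambda>i.
     let aA = i div (q * d); bB = i mod (q * d);
         a = aA div d; A = aA mod d; b = bB div d; B = bB mod d
     in \<phi> $ (A * d + B) * \<Psi> $ (a * q + b))"

definition LOCC_distinguishable_with ::
    "nat \<Rightarrow> nat \<Rightarrow> complex vec \<Rightarrow> complex vec set \<Rightarrow> bool" where
  "LOCC_distinguishable_with q d \<Psi> S \<longleftrightarrow>
     (\<exists>P. valid_protocol (q * d) (q * d) P \<and>
       (\<forall>xs \<in> outcome_seqs P. \<forall>\<phi> \<in> S. \<forall>\<chi> \<in> S.
          outcome_prob (q * d) (q * d) P (assisted q d \<phi> \<Psi>) xs \<noteq> 0 \<and>
          outcome_prob (q * d) (q * d) P (assisted q d \<chi> \<Psi>) xs \<noteq> 0 \<longrightarrow> \<phi> = \<chi>))"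

section \<open>The product states\<close>

definition omega :: "nat \<Rightarrow> nat \<Rightarrow> complex" where
  "omega d t = exp (2 * of_real pi * \<i> / of_nat (d - 1 - 2 * t))"

definition fourier :: "nat \<Rightarrow> nat \<Rightarrow> nat \<Rightarrow> nat \<Rightarrow> nat \<Rightarrow> complex vec" where
  "fourier d t k lo hi = vec d (\<lambda>j. if lo \<le> j \<and> j \<le> hi then omega d t ^ (j * k) else 0)"

definition stopper :: "nat \<Rightarrow> complex vec" where
  "stopper d = vec d (\<lambda>_. 1) \<otimes>v vec d (\<lambda>_. 1)"

definition U_states :: "nat \<Rightarrow> complex vec set" where
  "U_states d = (\<Union>t \<in> {0..(d - 3) div 2}. \<Union>k \<in> {1..d - 2 - 2 * t}.
      {unit_vec d t \<otimes>v fourier d t k t (d - 2 - t),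
       fourier d t k t (d - 2 - t) \<otimes>v unit_vec d (d - 1 - t),
       unit_vec d (d - 1 - t) \<otimes>v fourier d t k (t + 1) (d - 1 - t),
       fourier d t k (t + 1) (d - 1 - t) \<otimes>v unit_vec d t})
    \<union> {stopper d}"

section \<open>Sanity checks\<close>

lemma mod_div_less:
  fixes i m n :: nat
  assumes "i < m * n" shows "i div n < m" "i mod n < n"
proof -
  have "n > 0" using assms by (cases n) auto
  then show "i mod n < n" by simp
  show "i div n < m" using assms by (simp add: less_mult_imp_div_less)
qed

lemma pair_index_less:
  fixes i j m n :: nat
  assumes "i < m" "j < n" shows "i * n + j < m * n"
proof -
  have "i * n + j < (i + 1) * n" using assms by simp
  also have "\<dots> \<le> m * n" using assms by (intro mult_right_mono) auto
  finally show ?thesis .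
qed

lemma dim_tensor_vec [simp]: "dim_vec (u \<otimes>v v) = dim_vec u * dim_vec v"
  by (simp add: tensor_vec_def)

lemma index_tensor_vec:
  assumes "i < dim_vec u" "j < dim_vec v"
  shows "(u \<otimes>v v) $ (i * dim_vec v + j) = u $ i * v $ j"
proof -
  have "(i * dim_vec v + j) div dim_vec v = i" using assms(2) by (subst div_mult_self3) auto
  then show ?thesis using assms pair_index_less[OF assms] by (simp add: tensor_vec_def)
qed

lemma assisted_tensor_vec:
  assumes u: "dim_vec u = d" and v: "dim_vec v = d" and a: "dim_vec \<alpha> = q" and b: "dim_vec \<beta> = q"
  shows "assisted q d (u \<otimes>v v) (\<alpha> \<otimes>v \<beta>) = (\<alpha> \<otimes>v u) \<otimes>v (\<beta> \<otimes>v v)"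
proof (rule eq_vecI)
  fix i assume "i < dim_vec ((\<alpha> \<otimes>v u) \<otimes>v (\<beta> \<otimes>v v))"
  then have i: "i < (q * d) * (q * d)" using assms by simp
  let ?x = "i div (q * d)" and ?y = "i mod (q * d)"
  have x: "?x < q * d" and y: "?y < q * d" using mod_div_less[OF i] by auto
  note xx = mod_div_less[OF x] and yy = mod_div_less[OF y]
  have 1: "(u \<otimes>v v) $ (?x mod d * d + ?y mod d) = u $ (?x mod d) * v $ (?y mod d)"
    using index_tensor_vec[of "?x mod d" u "?y mod d" v] xx yy u v by simp
  have 2: "(\<alpha> \<otimes>v \<beta>) $ (?x div d * q + ?y div d) = \<alpha> $ (?x div d) * \<beta> $ (?y div d)"
    using index_tensor_vec[of "?x div d" \<alpha> "?y div d" \<beta>] xx yy a b by simp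
  have 3: "(\<alpha> \<otimes>v u) $ ?x = \<alpha> $ (?x div d) * u $ (?x mod d)"
    using x u a by (simp add: tensor_vec_def)
  have 4: "(\<beta> \<otimes>v v) $ ?y = \<beta> $ (?y div d) * v $ (?y mod d)"
    using y v b by (simp add: tensor_vec_def)
  have 5: "((\<alpha> \<otimes>v u) \<otimes>v (\<beta> \<otimes>v v)) $ i = (\<alpha> \<otimes>v u) $ ?x * (\<beta> \<otimes>v v) $ ?y"
    using i assms by (simp add: tensor_vec_def[of "\<alpha> \<otimes>v u"])
  have 6: "assisted q d (u \<otimes>v v) (\<alpha> \<otimes>v \<beta>) $ i =
      (u \<otimes>v v) $ (?x mod d * d + ?y mod d) * (\<alpha> \<otimes>v \<beta>) $ (?x div d * q + ?y div d)"
    using i by (simp add: assisted_def Let_def)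
  show "assisted q d (u \<otimes>v v) (\<alpha> \<otimes>v \<beta>) $ i = ((\<alpha> \<otimes>v u) \<otimes>v (\<beta> \<otimes>v v)) $ i"
    unfolding 5 6 1 2 3 4 by simp
qed (use assms in \<open>simp add: assisted_def\<close>)

lemma sum_div_mod:
  fixes f :: "nat \<Rightarrow> nat \<Rightarrow> complex"
  shows "(\<Sum>i = 0..<m * n. f (i div n) (i mod n)) = (\<Sum>i = 0..<m. \<Sum>j = 0..<n. f i j)"
proof -
  have "(\<Sum>i = 0..<m. \<Sum>j = 0..<n. f i j) = (\<Sum>(i, j) \<in> {0..<m} \<times> {0..<n}. f i j)"
    by (simp add: sum.cartesian_product)
  also have "\<dots> = (\<Sum>i = 0..<m * n. f (i div n) (i mod n))"
    by (rule sum.reindex_bij_witness[where i = "\<lambda>i. (i div n, i mod n)" and j = "\<lambda>(i, j). i * n + j"])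
       (auto simp: pair_index_less mod_div_less)
  finally show ?thesis by simp
qed

lemma cscalar_prod_tensor_vec:
  assumes "dim_vec u = dim_vec u'" "dim_vec v = dim_vec v'"
  shows "(u \<otimes>v v) \<bullet>c (u' \<otimes>v v') = (u \<bullet>c u') * (v \<bullet>c v')"
proof -
  let ?m = "dim_vec u'" and ?n = "dim_vec v'"
  have "(u \<otimes>v v) \<bullet>c (u' \<otimes>v v') =
      (\<Sum>i = 0..<?m * ?n. (u $ (i div ?n) * cnj (u' $ (i div ?n))) * (v $ (i mod ?n) * cnj (v' $ (i mod ?n))))"
    unfolding scalar_prod_def using assms
    by (auto intro!: sum.cong simp: tensor_vec_def)
  also have "\<dots> = (\<Sum>i = 0..<?m. \<Sum>j = 0..<?n. (u $ i * cnj (u' $ i)) * (v $ j * cnj (v' $ j)))"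
    by (rule sum_div_mod)
  also have "\<dots> = (u \<bullet>c u') * (v \<bullet>c v')"
    by (simp add: scalar_prod_def sum_product)
  finally show ?thesis .
qed

lemma omega_cis: "omega d t = cis (2 * pi / real (d - 1 - 2 * t))"
  by (simp add: omega_def cis_conv_exp mult.commute)

lemma cis_frac_neq_1:
  fixes k :: int
  assumes "k \<noteq> 0" "\<bar>k\<bar> < int n"
  shows "cis (2 * pi * of_int k / real n) \<noteq> 1"
proof
  have n: "n > 0" using assms by auto
  assume "cis (2 * pi * of_int k / real n) = 1"
  then have "cos (2 * pi * of_int k / real n) = 1" by (metis cis.simps(1) one_complex.simps(1))
  then obtain z :: int where "2 * pi * of_int k / real n = of_int z * 2 * pi"
    using cos_one_2pi_int by auto
  then have "of_int k = (of_int (z * int n) :: real)" using n by (simp add: field_simps)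
  then have "k = z * int n" by (simp only: of_int_eq_iff)
  then have "int n dvd k" by simp
  then show False using assms dvd_imp_le_int[of k "int n"] by auto
qed

lemma sum_roots_eq_0:
  fixes z :: complex
  assumes "z ^ n = 1" "z \<noteq> 1"
  shows "(\<Sum>j \<in> {a..<a + n}. z ^ j) = 0"
proof -
  have "(\<Sum>j \<in> {a..<a + n}. z ^ j) = z ^ a * (\<Sum>j < n. z ^ j)"
    by (simp add: sum_distrib_left flip: power_add)
       (rule sum.reindex_bij_witness[where i = "\<lambda>j. a + j" and j = "\<lambda>j. j - a"], auto)
  also have "(\<Sum>j < n. z ^ j) = 0"
    using assms by (simp add: geometric_sum)
  finally show ?thesis by simp
qed

lemma cscalar_prod_fourier:
  assumes n: "n = d - 1 - 2 * t" "n > 0" and hi: "hi + 1 = lo + n" "hi < d"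
    and k: "k < n" "k' < n" "k \<noteq> k'"
  shows "fourier d t k lo hi \<bullet>c fourier d t k' lo hi = 0"
proof -
  let ?w = "omega d t"
  define z where "z = ?w ^ k * cnj ?w ^ k'"
  have w: "?w = cis (2 * pi / real n)" by (simp add: omega_cis n)
  have z: "z = cis (2 * pi * of_int (int k - int k') / real n)"
    unfolding z_def w cis_cnj
    by (simp add: Complex.DeMoivre cis_mult) (simp add: field_simps diff_divide_distrib)
  have "z ^ n = cis (2 * pi * of_int (int k - int k'))"
    using n(2) unfolding z by (simp add: Complex.DeMoivre)
  also have "\<dots> = 1"
    by (rule cis_multiple_2pi) (rule Ints_of_int)
  finally have z1: "z ^ n = 1" .
  have z2: "z \<noteq> 1" unfolding z using k by (intro cis_frac_neq_1) auto
  have "fourier d t k lo hi \<bullet>c fourier d t k' lo hi = (\<Sum>j = 0..<d. if lo \<le> j \<and> j \<le> hi then z ^ j else 0)"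
    by (auto simp: scalar_prod_def fourier_def z_def power_mult_distrib power_mult[symmetric] mult.commute
          intro!: sum.cong)
  also have "\<dots> = (\<Sum>j \<in> {lo..<lo + n}. z ^ j)"
    using hi by (intro sum.mono_neutral_cong_right) auto
  also have "\<dots> = 0" using z1 z2 by (rule sum_roots_eq_0)
  finally show ?thesis .
qed

lemma cscalar_prod_disjoint:
  fixes u v :: "complex vec"
  assumes "\<And>j. j < dim_vec v \<Longrightarrow> u $ j = 0 \<or> v $ j = 0"
  shows "u \<bullet>c v = 0"
  unfolding scalar_prod_def using assms by (intro sum.neutral) fastforce

text \<open>The states other than the stopper, with \<open>c < 4\<close> selecting one of the four families.\<close>

definition row_part :: "nat \<Rightarrow> nat \<times> nat \<times> nat \<Rightarrow> complex vec" where
  "row_part d = (\<lambda>(t, k, c). if c = 0 then unit_vec d t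
     else if c = 1 then fourier d t k t (d - 2 - t)
     else if c = 2 then unit_vec d (d - 1 - t) else fourier d t k (t + 1) (d - 1 - t))"

definition col_part :: "nat \<Rightarrow> nat \<times> nat \<times> nat \<Rightarrow> complex vec" where
  "col_part d = (\<lambda>(t, k, c). if c = 0 then fourier d t k t (d - 2 - t)
     else if c = 1 then unit_vec d (d - 1 - t)
     else if c = 2 then fourier d t k (t + 1) (d - 1 - t) else unit_vec d t)"

definition index_set :: "nat \<Rightarrow> (nat \<times> nat \<times> nat) set" where
  "index_set d = (SIGMA t:{0..(d - 3) div 2}. {1..d - 2 - 2 * t} \<times> {0..<4})"

definition tile_state :: "nat \<Rightarrow> nat \<times> nat \<times> nat \<Rightarrow> complex vec" where
  "tile_state d x = row_part d x \<otimes>v col_part d x"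

lemma U_states_eq: "U_states d = tile_state d ` index_set d \<union> {stopper d}"
proof -
  have four: "{0..<4} = {0, 1, 2, 3 :: nat}" by auto
  have "tile_state d ` index_set d = (\<Union>t \<in> {0..(d - 3) div 2}. \<Union>k \<in> {1..d - 2 - 2 * t}.
      (\<lambda>c. tile_state d (t, k, c)) ` {0..<4})"
    unfolding index_set_def by (auto simp: image_iff)
  also have "\<dots> = (\<Union>t \<in> {0..(d - 3) div 2}. \<Union>k \<in> {1..d - 2 - 2 * t}.
      {unit_vec d t \<otimes>v fourier d t k t (d - 2 - t),
       fourier d t k t (d - 2 - t) \<otimes>v unit_vec d (d - 1 - t),
       unit_vec d (d - 1 - t) \<otimes>v fourier d t k (t + 1) (d - 1 - t),
       fourier d t k (t + 1) (d - 1 - t) \<otimes>v unit_vec d t})"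
    unfolding four by (simp add: tile_state_def row_part_def col_part_def)
  finally show ?thesis by (simp add: U_states_def)
qed

lemma dim_parts [simp]: "dim_vec (row_part d x) = d" "dim_vec (col_part d x) = d"
  by (auto simp: row_part_def col_part_def fourier_def split: prod.splits)

lemma fourier_index:
  "j < d \<Longrightarrow> fourier d t k lo hi $ j = (if lo \<le> j \<and> j \<le> hi then omega d t ^ (j * k) else 0)"
  by (simp add: fourier_def)

lemma dim_fourier [simp]: "dim_vec (fourier d t k lo hi) = d"
  by (simp add: fourier_def)

lemma fourier_orth:
  assumes "d \<ge> 3" "t \<le> (d - 3) div 2" "k \<in> {1..d - 2 - 2 * t}" "k' \<in> {1..d - 2 - 2 * t}" "k \<noteq> k'"
  shows "fourier d t k t (d - 2 - t) \<bullet>c fourier d t k' t (d - 2 - t) = 0"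
    "fourier d t k (t + 1) (d - 1 - t) \<bullet>c fourier d t k' (t + 1) (d - 1 - t) = 0"
  by (rule cscalar_prod_fourier[OF refl]; use assms in auto)+

lemma tile_orth:
  assumes d: "d \<ge> 3" and x: "x \<in> index_set d" and y: "y \<in> index_set d" and ne: "x \<noteq> y"
  shows "tile_state d x \<bullet>c tile_state d y = 0"
proof -
  obtain t k c t' k' c' where xy: "x = (t, k, c)" "y = (t', k', c')" by (metis prod_cases3)
  have t: "2 * t + 3 \<le> d" "2 * t' + 3 \<le> d" and k: "k \<in> {1..d - 2 - 2 * t}" "k' \<in> {1..d - 2 - 2 * t'}"
    and c: "c < 4" "c' < 4"
    using x y d by (auto simp: xy index_set_def)
  have t2: "t \<le> (d - 3) div 2" using t by auto
  have "row_part d x \<bullet>c row_part d y = 0 \<or> col_part d x \<bullet>c col_part d y = 0"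
  proof (cases "t = t' \<and> c = c'")
    case True
    then have "k \<noteq> k'" using ne xy by auto
    then show ?thesis using True k t2 d fourier_orth[of d t k k'] c
      by (auto simp: xy row_part_def col_part_def)
  next
    case False
    let ?I = "\<lambda>t c. if c = 0 then {t} else if c = 1 then {t..d - 2 - t}
       else if c = 2 then {d - 1 - t} else {t + 1..d - 1 - t :: nat}"
    let ?J = "\<lambda>t c. if c = 0 then {t..d - 2 - t} else if c = 1 then {d - 1 - t}
       else if c = 2 then {t + 1..d - 1 - t} else {t :: nat}"
    have row0: "row_part d (t, k, c) $ j = 0" if "j < d" "j \<notin> ?I t c" "2 * t + 3 \<le> d" for t k c j
      using that by (cases "c = 0"; cases "c = 1"; cases "c = 2")
         (auto simp: row_part_def fourier_index)
    have col0: "col_part d (t, k, c) $ j = 0" if "j < d" "j \<notin> ?J t c" "2 * t + 3 \<le> d" for t k c j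
      using that by (cases "c = 0"; cases "c = 1"; cases "c = 2")
         (auto simp: col_part_def fourier_index)
    have c4: "c \<in> {0, 1, 2, 3}" "c' \<in> {0, 1, 2, 3}" using c by auto
    have "(\<forall>j. j \<notin> ?I t c \<or> j \<notin> ?I t' c') \<or> (\<forall>j. j \<notin> ?J t c \<or> j \<notin> ?J t' c')"
    proof (rule ccontr)
      assume "\<not> ?thesis"
      then obtain i j where "i \<in> ?I t c" "i \<in> ?I t' c'" "j \<in> ?J t c" "j \<in> ?J t' c'" by blast
      then show False using c4 False t
        by (elim insertE emptyE) auto
    qed
    then show ?thesis
    proof
      assume *: "\<forall>j. j \<notin> ?I t c \<or> j \<notin> ?I t' c'"
      have "row_part d x \<bullet>c row_part d y = 0"
      proof (rule cscalar_prod_disjoint)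
        fix j assume "j < dim_vec (row_part d y)"
        then have j: "j < d" by simp
        from * have "j \<notin> ?I t c \<or> j \<notin> ?I t' c'" by (rule spec)
        then show "row_part d x $ j = 0 \<or> row_part d y $ j = 0"
          unfolding xy using row0[OF j _ t(1)] row0[OF j _ t(2)] by blast
      qed
      then show ?thesis ..
    next
      assume *: "\<forall>j. j \<notin> ?J t c \<or> j \<notin> ?J t' c'"
      have "col_part d x \<bullet>c col_part d y = 0"
      proof (rule cscalar_prod_disjoint)
        fix j assume "j < dim_vec (col_part d y)"
        then have j: "j < d" by simp
        from * have "j \<notin> ?J t c \<or> j \<notin> ?J t' c'" by (rule spec)
        then show "col_part d x $ j = 0 \<or> col_part d y $ j = 0"
          unfolding xy using col0[OF j _ t(1)] col0[OF j _ t(2)] by blast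
      qed
      then show ?thesis ..
    qed
  qed
  then show ?thesis by (auto simp: tile_state_def cscalar_prod_tensor_vec)
qed

lemma tile_stopper_orth:
  assumes d: "d \<ge> 3" and x: "x \<in> index_set d"
  shows "tile_state d x \<bullet>c stopper d = 0"
proof -
  obtain t k c where xy: "x = (t, k, c)" by (metis prod_cases3)
  have t: "2 * t + 3 \<le> d" and k: "k \<in> {1..d - 2 - 2 * t}"
    using x d by (auto simp: xy index_set_def)
  let ?e = "vec d (\<lambda>_. 1) :: complex vec"
  have *: "fourier d t k lo hi \<bullet>c ?e = 0" if "hi + 1 = lo + (d - 1 - 2 * t)" "hi < d" for lo hi
  proof -
    have "fourier d t k lo hi \<bullet>c ?e = fourier d t k lo hi \<bullet>c fourier d t 0 lo hi"
      by (auto simp: scalar_prod_def fourier_index intro!: sum.cong)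
    also have "\<dots> = 0" by (rule cscalar_prod_fourier[OF refl]; use that t k in auto)
    finally show ?thesis .
  qed
  have "row_part d x \<bullet>c ?e = 0 \<or> col_part d x \<bullet>c ?e = 0"
    using *[of "d - 2 - t" t] *[of "d - 1 - t" "t + 1"] t by (auto simp: xy row_part_def col_part_def)
  then show ?thesis by (auto simp: tile_state_def stopper_def cscalar_prod_tensor_vec)
qed

lemma vec_neq_0I: "j < dim_vec u \<Longrightarrow> u $ j \<noteq> 0 \<Longrightarrow> u \<bullet>c u \<noteq> (0 :: complex)"
  by (metis carrier_vec_dim_vec conjugate_square_eq_0_vec index_zero_vec(1))

lemma tile_nonzero:
  assumes d: "d \<ge> 3" and x: "x \<in> index_set d"
  shows "tile_state d x \<bullet>c tile_state d x \<noteq> 0"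
proof -
  obtain t k c where xy: "x = (t, k, c)" by (metis prod_cases3)
  have t: "2 * t + 3 \<le> d" and c: "c < 4"
    using x d by (auto simp: xy index_set_def)
  have w: "omega d t \<noteq> 0" by (simp add: omega_def)
  have u: "unit_vec d i \<bullet>c unit_vec d i \<noteq> (0 :: complex)" if "i < d" for i
    using that by (intro vec_neq_0I[of i]) auto
  have f: "fourier d t k lo hi \<bullet>c fourier d t k lo hi \<noteq> 0" if "lo \<le> hi" "hi < d" for lo hi
    using that w by (intro vec_neq_0I[of lo]) (auto simp: fourier_index)
  have "row_part d x \<bullet>c row_part d x \<noteq> 0" "col_part d x \<bullet>c col_part d x \<noteq> 0"
    using t u[of t] u[of "d - 1 - t"] f[of t "d - 2 - t"] f[of "t + 1" "d - 1 - t"]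
    by (auto simp: xy row_part_def col_part_def)
  then show ?thesis by (simp add: tile_state_def cscalar_prod_tensor_vec)
qed

lemma stopper_nonzero:
  assumes "d \<ge> 1" shows "stopper d \<bullet>c stopper d \<noteq> 0"
proof -
  have "(vec d (\<lambda>_. 1) :: complex vec) \<bullet>c vec d (\<lambda>_. 1) \<noteq> 0"
    using assms by (intro vec_neq_0I[of 0]) auto
  then show ?thesis by (simp add: stopper_def cscalar_prod_tensor_vec)
qed

lemma U_states_carrier: "U_states d \<subseteq> carrier_vec (d * d)"
proof -
  have "tile_state d x \<in> carrier_vec (d * d)" for x
    by (rule carrier_vecI) (simp add: tile_state_def)
  moreover have "stopper d \<in> carrier_vec (d * d)"
    by (rule carrier_vecI) (simp add: stopper_def)
  ultimately show ?thesis unfolding U_states_eq by blast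
qed

lemma U_states_nonzero:
  assumes "d \<ge> 3" "\<phi> \<in> U_states d" shows "\<phi> \<bullet>c \<phi> \<noteq> 0"
  using assms tile_nonzero[OF assms(1)] stopper_nonzero[of d] unfolding U_states_eq by auto

lemma cscalar_prod_swap:
  fixes u v :: "complex vec"
  assumes "dim_vec u = dim_vec v" "u \<bullet>c v = 0" shows "v \<bullet>c u = 0"
proof -
  have "v \<bullet>c u = cnj (u \<bullet>c v)"
    using assms(1) by (simp add: scalar_prod_def mult.commute)
  then show ?thesis using assms by simp
qed

lemma U_states_orthogonal:
  assumes d: "d \<ge> 3" and "\<phi> \<in> U_states d" "\<chi> \<in> U_states d" "\<phi> \<noteq> \<chi>"
  shows "\<phi> \<bullet>c \<chi> = 0"
proof -
  have "stopper d \<bullet>c tile_state d x = 0" if "x \<in> index_set d" for x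
    using tile_stopper_orth[OF d that] by (rule cscalar_prod_swap[rotated]) (simp add: tile_state_def stopper_def)
  then show ?thesis using assms tile_orth[OF d] tile_stopper_orth[OF d] unfolding U_states_eq by blast
qed

lemma card_index_set:
  assumes d: "odd d" "d \<ge> 3" shows "card (index_set d) = (d - 1)\<^sup>2"
proof -
  define n where "n = (d - 3) div 2"
  have n: "d = 2 * n + 3" unfolding n_def using d by presburger
  have "card (index_set d) = (\<Sum>t = 0..n. 4 * (2 * n + 1 - 2 * t))"
    unfolding index_set_def n by (simp add: card_cartesian_product mult.commute)
  also have "\<dots> = (\<Sum>t = 0..n. 4 * (2 * t + 1))"
    by (rule sum.reindex_bij_witness[where i = "\<lambda>t. n - t" and j = "\<lambda>t. n - t"]) auto
  also have "\<dots> = (2 * n + 2)\<^sup>2"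
    by (induction n) (auto simp: power2_eq_square algebra_simps)
  finally show ?thesis by (simp add: n)
qed

lemma card_U_states:
  assumes d: "odd d" "d \<ge> 3" shows "card (U_states d) = (d - 1)\<^sup>2 + 1"
proof -
  have inj: "inj_on (tile_state d) (index_set d)"
    by (rule inj_onI) (metis d(2) tile_nonzero tile_orth)
  have "stopper d \<notin> tile_state d ` index_set d"
    using tile_stopper_orth[OF d(2)] stopper_nonzero[of d] d by fastforce
  moreover have "finite (index_set d)" unfolding index_set_def by auto
  ultimately show ?thesis
    by (simp add: U_states_eq card_image[OF inj] card_index_set[OF d])
qed

end

theory Submission
  imports Defs
begin

text \<open>Write \<open>d = 2n + 3\<close> and give the columns \<open>0, \<dots>, n + 1\<close> a common label and each of the \<open>n + 1\<close>
  columns further right a label of its own: \<open>n + 2 = (d + 1) / 2\<close> labels in all.  Bob's first measurement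
  uses the entanglement to copy the label of his column to Alice, up to a cyclic shift given by the outcome.
  Then the tiles are removed ring by ring.  In the outermost ring Alice can project onto
  the top tile (top row, last label absent), then onto the right tile (last label, bottom row absent); Bob
  projects onto his first column, which by then is the left tile; what remains of the bottom row is the
  bottom tile.  Each projection onto a tile keeps or kills every state but the stopper, so orthogonality
  survives.  Within a tile one party's index is constant, so its label register is determined by the other
  party's index; a Fourier measurement decouples it and leaves
  orthogonal states on the other side.\<close>

section \<open>Local operations and protocols\<close>

fun other :: "party \<Rightarrow> party" where
  "other Alice = Bob"
| "other Bob = Alice"

definition party_dim :: "nat \<Rightarrow> nat \<Rightarrow> party \<Rightarrow> nat" where
  "party_dim m n p = (case p of Alice \<Rightarrow> m | Bob \<Rightarrow> n)"

text \<open>Together with \<open>join\<close>, this splits a joint index into the coordinates seen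
  from party \<open>p\<close>, so that facts about local operations are proved once for both
  parties.\<close>

definition own :: "nat \<Rightarrow> party \<Rightarrow> nat \<Rightarrow> nat" where
  "own n p i = (case p of Alice \<Rightarrow> i div n | Bob \<Rightarrow> i mod n)"

definition join :: "nat \<Rightarrow> party \<Rightarrow> nat \<Rightarrow> nat \<Rightarrow> nat" where
  "join n p x y = (case p of Alice \<Rightarrow> x * n + y | Bob \<Rightarrow> y * n + x)"

lemma own_less: "i < m * n \<Longrightarrow> own n p i < party_dim m n p"
  by (cases p) (auto simp: own_def party_dim_def mod_div_less)

lemma join_own: "join n p (own n p i) (own n (other p) i) = i"
  by (cases p) (auto simp: own_def join_def)

lemma own_join:
  assumes "x < party_dim m n p" "y < party_dim m n (other p)"
  shows "own n p (join n p x y) = x" "own n (other p) (join n p x y) = y"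
    "join n p x y < m * n"
  using assms by (cases p; auto simp: own_def join_def party_dim_def pair_index_less)+

lemma sum_own:
  fixes f :: "nat \<Rightarrow> complex"
  shows "(\<Sum>i<m * n. f i) =
    (\<Sum>y<party_dim m n (other p). \<Sum>x<party_dim m n p. f (join n p x y))"
proof -
  have "(\<Sum>y<party_dim m n (other p). \<Sum>x<party_dim m n p. f (join n p x y)) =
      (\<Sum>(y, x) \<in> {..<party_dim m n (other p)} \<times> {..<party_dim m n p}. f (join n p x y))"
    by (simp add: sum.cartesian_product)
  also have "\<dots> = (\<Sum>i<m * n. f i)"
    by (rule sum.reindex_bij_witness[where i = "\<lambda>i. (own n (other p) i, own n p i)"
          and j = "\<lambda>(y, x). join n p x y"])
       (auto simp: own_less own_join join_own)
  finally show ?thesis by simp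
qed

lemma local_op_carrier:
  assumes "M \<in> carrier_mat (party_dim m n p) (party_dim m n p)"
  shows "local_op m n p M \<in> carrier_mat (m * n) (m * n)"
  using assms by (cases p) (auto simp: local_op_def tensor_mat_def party_dim_def)

lemma local_op_index:
  assumes M: "M \<in> carrier_mat (party_dim m n p) (party_dim m n p)"
    and \<psi>: "\<psi> \<in> carrier_vec (m * n)" and i: "i < m * n"
  shows "(local_op m n p M *\<^sub>v \<psi>) $ i =
    (\<Sum>x<party_dim m n p. M $$ (own n p i, x) * \<psi> $ join n p x (own n (other p) i))"
proof -
  let ?y = "own n (other p) i"
  have y: "?y < party_dim m n (other p)" using own_less[OF i] .
  \<comment> \<open>The identity factor fixes the other party's coordinate, so only one block of the
    double sum survives.\<close>
  have entry: "local_op m n p M $$ (i, join n p x y) = M $$ (own n p i, x) * (if y = ?y then 1 else 0)"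
    if x: "x < party_dim m n p" and y: "y < party_dim m n (other p)" for x y
  proof -
    note j = own_join[OF x y]
    show ?thesis using j i M mod_div_less[OF i] mod_div_less[OF j(3)] x y
      by (cases p) (auto simp: local_op_def tensor_mat_def own_def party_dim_def)
  qed
  have "(local_op m n p M *\<^sub>v \<psi>) $ i = (\<Sum>k<m * n. local_op m n p M $$ (i, k) * \<psi> $ k)"
    using local_op_carrier[OF M] \<psi> i
    by (simp add: scalar_prod_def atLeast0LessThan row_def)
  also have "\<dots> = (\<Sum>y<party_dim m n (other p). \<Sum>x<party_dim m n p.
      local_op m n p M $$ (i, join n p x y) * \<psi> $ join n p x y)"
    by (rule sum_own)
  also have "\<dots> = (\<Sum>y<party_dim m n (other p). if y = ?y then
      (\<Sum>x<party_dim m n p. M $$ (own n p i, x) * \<psi> $ join n p x y) else 0)"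
    by (intro sum.cong refl) (simp add: entry)
  also have "\<dots> = (\<Sum>x<party_dim m n p. M $$ (own n p i, x) * \<psi> $ join n p x ?y)"
    using y by simp
  finally show ?thesis .
qed

section \<open>Kraus completeness and discrimination of indexed families\<close>

lemma kraus_familyI:
  assumes M: "\<And>x. x < r \<Longrightarrow> M x \<in> carrier_mat n n"
    and sum: "\<And>i j. i < n \<Longrightarrow> j < n \<Longrightarrow>
      (\<Sum>x<r. \<Sum>k<n. cnj (M x $$ (k, i)) * M x $$ (k, j)) = (if i = j then 1 else 0)"
  shows "kraus_family n r M"
  unfolding kraus_family_def
proof (intro conjI allI impI)
  show "mat n n (\<lambda>(i, j). \<Sum>x<r. (mat_adjoint (M x) * M x) $$ (i, j)) = 1\<^sub>m n"
  proof (rule eq_matI)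
    fix i j assume "i < dim_row (1\<^sub>m n :: complex mat)" "j < dim_col (1\<^sub>m n :: complex mat)"
    then have ij: "i < n" "j < n" by auto
    have "(mat_adjoint (M x) * M x) $$ (i, j) = (\<Sum>k<n. cnj (M x $$ (k, i)) * M x $$ (k, j))"
      if "x < r" for x
      using M[OF that] ij
      by (simp add: mat_adjoint_def scalar_prod_def atLeast0LessThan mat_of_rows_def)
    then show "mat n n (\<lambda>(i, j). \<Sum>x<r. (mat_adjoint (M x) * M x) $$ (i, j)) $$ (i, j) = 1\<^sub>m n $$ (i, j)"
      using ij sum by simp
  qed auto
qed (use M in auto)

text \<open>A family rather than a set of vectors: measurements may send several states to the same
  vector, typically zero, and the index remembers which state it came from. Nonzero vectors stand in
  for nonzero probabilities, so no normalization enters.\<close>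

definition distinguishable :: "nat \<Rightarrow> nat \<Rightarrow> 'a set \<Rightarrow> ('a \<Rightarrow> complex vec) \<Rightarrow> bool" where
  "distinguishable m n J f \<longleftrightarrow> (\<exists>P. valid_protocol m n P \<and>
     (\<forall>xs \<in> outcome_seqs P. \<forall>j \<in> J. \<forall>k \<in> J.
        post_state m n P xs (f j) \<noteq> 0\<^sub>v (m * n) \<and> post_state m n P xs (f k) \<noteq> 0\<^sub>v (m * n) \<longrightarrow> j = k))"

lemma distinguishable_Stop:
  assumes "\<And>j k. \<lbrakk>j \<in> J; k \<in> J; f j \<noteq> 0\<^sub>v (m * n); f k \<noteq> 0\<^sub>v (m * n)\<rbrakk> \<Longrightarrow> j = k"
  shows "distinguishable m n J f"
  unfolding distinguishable_def by (rule exI[of _ Stop]) (auto intro: assms)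

lemma distinguishable_Measure:
  assumes M: "kraus_family (party_dim m n p) r M"
    and C: "\<And>x. x < r \<Longrightarrow> distinguishable m n J (\<lambda>j. local_op m n p (M x) *\<^sub>v f j)"
  shows "distinguishable m n J f"
proof -
  have "\<forall>x. \<exists>P. x < r \<longrightarrow> valid_protocol m n P \<and> (\<forall>xs \<in> outcome_seqs P. \<forall>j \<in> J. \<forall>k \<in> J.
        post_state m n P xs (local_op m n p (M x) *\<^sub>v f j) \<noteq> 0\<^sub>v (m * n) \<and>
        post_state m n P xs (local_op m n p (M x) *\<^sub>v f k) \<noteq> 0\<^sub>v (m * n) \<longrightarrow> j = k)"
    using C unfolding distinguishable_def by blast
  then obtain P where P: "\<forall>x<r. valid_protocol m n (P x) \<and> (\<forall>xs \<in> outcome_seqs (P x). \<forall>j \<in> J. \<forall>k \<in> J.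
        post_state m n (P x) xs (local_op m n p (M x) *\<^sub>v f j) \<noteq> 0\<^sub>v (m * n) \<and>
        post_state m n (P x) xs (local_op m n p (M x) *\<^sub>v f k) \<noteq> 0\<^sub>v (m * n) \<longrightarrow> j = k)"
    by metis
  show ?thesis unfolding distinguishable_def
  proof (rule exI[of _ "Measure p r M P"], intro conjI)
    show "valid_protocol m n (Measure p r M P)"
      using M P by (simp add: party_dim_def)
  qed (use P in auto)
qed

lemma distinguishable_cong:
  assumes "distinguishable m n J g" "\<And>j. j \<in> J \<Longrightarrow> f j = g j"
  shows "distinguishable m n J f"
  using assms unfolding distinguishable_def by simp

text \<open>The Born formula vanishes on a zero vector, so an outcome of nonzero probability leaves
  a nonzero one.\<close>

lemma LOCC_distinguishable_withI:
  assumes "distinguishable (q * d) (q * d) S (\<lambda>\<phi>. assisted q d \<phi> \<Psi>)"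
  shows "LOCC_distinguishable_with q d \<Psi> S"
proof -
  let ?N = "q * d"
  have "post_state ?N ?N P xs \<psi> \<noteq> 0\<^sub>v (?N * ?N)" if "outcome_prob ?N ?N P \<psi> xs \<noteq> 0" for P \<psi> xs
    using that by (auto simp: outcome_prob_def)
  moreover obtain P where "valid_protocol ?N ?N P" "\<And>xs \<phi> \<chi>. \<lbrakk>xs \<in> outcome_seqs P; \<phi> \<in> S; \<chi> \<in> S;
      post_state ?N ?N P xs (assisted q d \<phi> \<Psi>) \<noteq> 0\<^sub>v (?N * ?N);
      post_state ?N ?N P xs (assisted q d \<chi> \<Psi>) \<noteq> 0\<^sub>v (?N * ?N)\<rbrakk> \<Longrightarrow> \<phi> = \<chi>"
    using assms unfolding distinguishable_def by metis
  ultimately show ?thesis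
    unfolding LOCC_distinguishable_with_def by (intro exI[of _ P]) simp
qed

section \<open>Measurements\<close>

text \<open>Coordinate projectors onto the fibres of \<open>l\<close>; their effect on a vector is
  mere restriction of its support.\<close>

definition sort_kraus :: "nat \<Rightarrow> (nat \<Rightarrow> nat) \<Rightarrow> nat \<Rightarrow> complex mat" where
  "sort_kraus n l x = mat n n (\<lambda>(i, j). if i = j \<and> l i = x then 1 else 0)"

lemma kraus_sort:
  assumes "\<And>i. i < n \<Longrightarrow> l i < r"
  shows "kraus_family n r (sort_kraus n l)"
proof (rule kraus_familyI)
  fix i j assume ij: "i < n" "j < n"
  have "(\<Sum>k<n. cnj (sort_kraus n l x $$ (k, i)) * sort_kraus n l x $$ (k, j)) =
      (if x = l i then (if i = j then 1 else 0) else 0)" for x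
  proof -
    have "(\<Sum>k<n. cnj (sort_kraus n l x $$ (k, i)) * sort_kraus n l x $$ (k, j)) =
      (\<Sum>k<n. if k = i then (if i = j \<and> l i = x then 1 else 0) else 0)"
      using ij by (intro sum.cong) (auto simp: sort_kraus_def)
    then show ?thesis using ij by auto
  qed
  then show "(\<Sum>x<r. \<Sum>k<n. cnj (sort_kraus n l x $$ (k, i)) * sort_kraus n l x $$ (k, j)) =
      (if i = j then 1 else 0)"
    using assms ij by simp
qed (simp add: sort_kraus_def)

lemma local_op_sort:
  assumes "\<psi> \<in> carrier_vec (m * n)"
  shows "local_op m n p (sort_kraus (party_dim m n p) l x) *\<^sub>v \<psi> =
    vec (m * n) (\<lambda>i. if l (own n p i) = x then \<psi> $ i else 0)"
proof (rule eq_vecI)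
  let ?M = "sort_kraus (party_dim m n p) l x"
  have M: "?M \<in> carrier_mat (party_dim m n p) (party_dim m n p)" by (simp add: sort_kraus_def)
  show "dim_vec (local_op m n p ?M *\<^sub>v \<psi>) = dim_vec (vec (m * n) (\<lambda>i. if l (own n p i) = x then \<psi> $ i else 0))"
    using local_op_carrier[OF M] by simp
  fix i assume "i < dim_vec (vec (m * n) (\<lambda>i. if l (own n p i) = x then \<psi> $ i else 0))"
  then have i: "i < m * n" by simp
  have "(local_op m n p ?M *\<^sub>v \<psi>) $ i = (\<Sum>z<party_dim m n p. if z = own n p i then
      (if l (own n p i) = x then \<psi> $ i else 0) else 0)"
    unfolding local_op_index[OF M assms i]
    using own_less[OF i, of p] by (intro sum.cong) (auto simp: sort_kraus_def join_own)
  then show "(local_op m n p ?M *\<^sub>v \<psi>) $ i = vec (m * n) (\<lambda>i. if l (own n p i) = x then \<psi> $ i else 0) $ i"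
    using own_less[OF i, of p] i by simp
qed

lemma distinguishable_sort:
  fixes l :: "nat \<Rightarrow> nat" and r :: nat
  assumes "\<And>j. j \<in> J \<Longrightarrow> f j \<in> carrier_vec (m * n)"
    and "\<And>i. i < party_dim m n p \<Longrightarrow> l i < r"
    and "\<And>x. x < r \<Longrightarrow> distinguishable m n J (\<lambda>j. vec (m * n) (\<lambda>i. if l (own n p i) = x then f j $ i else 0))"
  shows "distinguishable m n J f"
proof (rule distinguishable_Measure)
  show "kraus_family (party_dim m n p) r (sort_kraus (party_dim m n p) l)"
    using assms(2) by (rule kraus_sort)
  show "distinguishable m n J (\<lambda>j. local_op m n p (sort_kraus (party_dim m n p) l x) *\<^sub>v f j)" if "x < r" for x
    using assms(3)[OF that] by (rule distinguishable_cong) (simp add: local_op_sort assms(1))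
qed

text \<open>Rank one operators: a Fourier basis bra in row 0, so the measured system is reset to
  basis state 0.\<close>

definition fourier_kraus :: "nat \<Rightarrow> nat \<Rightarrow> complex mat" where
  "fourier_kraus n x = mat n n (\<lambda>(i, j). if i = 0 then cis (2 * pi * x * j / n) / sqrt n else 0)"

lemma kraus_fourier:
  assumes n: "n > 0"
  shows "kraus_family n n (fourier_kraus n)"
proof (rule kraus_familyI)
  fix i j assume ij: "i < n" "j < n"
  \<comment> \<open>The two phases combine to a power of an \<open>n\<close>-th root of unity, and
    the sum over the outcomes becomes a geometric series.\<close>
  define z where "z = cis (2 * pi * of_int (int j - int i) / real n)"
  have "(\<Sum>k<n. cnj (fourier_kraus n x $$ (k, i)) * fourier_kraus n x $$ (k, j)) = z ^ x / n" for x
  proof -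
    have "(\<Sum>k<n. cnj (fourier_kraus n x $$ (k, i)) * fourier_kraus n x $$ (k, j)) =
      (\<Sum>k<n. if k = 0 then cnj (fourier_kraus n x $$ (0, i)) * fourier_kraus n x $$ (0, j) else 0)"
      using ij by (intro sum.cong) (auto simp: fourier_kraus_def)
    also have "\<dots> = cis (- (2 * pi * x * i / n)) * cis (2 * pi * x * j / n) / (of_real (sqrt n) * of_real (sqrt n))"
      using ij n by (simp add: fourier_kraus_def cis_cnj)
    also have "of_real (sqrt n) * of_real (sqrt n) = (of_nat n :: complex)"
      by (metis of_nat_0_le_iff of_real_mult of_real_of_nat_eq real_sqrt_mult_self abs_of_nonneg)
    also have "cis (- (2 * pi * x * i / n)) * cis (2 * pi * x * j / n) = z ^ x"
      unfolding z_def cis_mult Complex.DeMoivre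
      by (rule arg_cong[where f = cis]) (simp add: algebra_simps diff_divide_distrib)
    finally show ?thesis .
  qed
  moreover have "(\<Sum>x<n. z ^ x / n) = (if i = j then 1 else 0)"
  proof (cases "i = j")
    case True
    then show ?thesis using n by (simp add: z_def)
  next
    case False
    have "z \<noteq> 1" unfolding z_def using ij False by (intro cis_frac_neq_1) auto
    moreover have "z ^ n = 1"
    proof -
      have "z ^ n = cis (2 * pi * of_int (int j - int i))"
        using n unfolding z_def by (simp add: Complex.DeMoivre)
      also have "\<dots> = 1" by (rule cis_multiple_2pi) (rule Ints_of_int)
      finally show ?thesis .
    qed
    ultimately show ?thesis using False
      by (simp add: geometric_sum flip: sum_divide_distrib)
  qed
  ultimately show "(\<Sum>x<n. \<Sum>k<n. cnj (fourier_kraus n x $$ (k, i)) * fourier_kraus n x $$ (k, j)) =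
      (if i = j then 1 else 0)"
    by simp
qed (simp add: fourier_kraus_def)


text \<open>The factor \<open>u\<close> of the other party is common to all states, so the
  orthogonality lies entirely with \<open>p\<close>, who measures the projectors onto the vectors
  \<open>v j\<close>.\<close>

lemma distinguishable_local:
  fixes v :: "'a \<Rightarrow> nat \<Rightarrow> complex" and u :: "nat \<Rightarrow> complex"
  assumes J: "finite J"
    and f: "\<And>j. j \<in> J \<Longrightarrow> f j \<in> carrier_vec (m * n)"
    and prod: "\<And>j i. \<lbrakk>j \<in> J; i < m * n\<rbrakk> \<Longrightarrow> f j $ i = u (own n (other p) i) * v j (own n p i)"
    and orth: "\<And>j k. \<lbrakk>j \<in> J; k \<in> J; j \<noteq> k\<rbrakk> \<Longrightarrow> (\<Sum>x<party_dim m n p. v j x * cnj (v k x)) = 0"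
  shows "distinguishable m n J f"
proof -
  define D where "D = party_dim m n p"
  define N where "N j = (\<Sum>x<D. v j x * cnj (v j x))" for j
  \<comment> \<open>The projector onto \<open>v j\<close>. If \<open>v j\<close> is zero, then
    \<open>N j\<close> is zero and division by zero makes this the zero matrix.\<close>
  define P where "P j a b = v j a * cnj (v j b) / N j" for j a b
  define S where "S a b = (\<Sum>j\<in>J. P j a b)" for a b
  have cnj_P: "cnj (P j a b) = P j b a" for j a b
    unfolding P_def N_def by (simp add: mult.commute)
  have P_v: "(\<Sum>b<D. P j a b * v k b) = (if j = k then v k a else 0)"
    if "j \<in> J" "k \<in> J" "a < D" for j k a
  proof -
    have "(\<Sum>b<D. P j a b * v k b) = v j a / N j * (\<Sum>b<D. v k b * cnj (v j b))"
      unfolding P_def sum_distrib_left by (intro sum.cong) auto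
    moreover have "v j a = 0" if "N j = 0"
    proof -
      have "N j = of_real (\<Sum>x<D. (cmod (v j x))\<^sup>2)"
        unfolding N_def by (simp only: complex_norm_square of_real_sum)
      with that have "(\<Sum>x<D. (cmod (v j x))\<^sup>2) = 0"
        by (metis of_real_eq_0_iff)
      then show ?thesis using \<open>a < D\<close> by (simp add: sum_nonneg_eq_0_iff)
    qed
    ultimately show ?thesis
      using that orth[of k j] by (auto simp: N_def[symmetric] D_def[symmetric])
  qed
  have P_P: "(\<Sum>k<D. P i a k * P j k b) = (if i = j then P j a b else 0)"
    if "i \<in> J" "j \<in> J" "a < D" for i j a b
  proof -
    have "(\<Sum>k<D. P i a k * P j k b) = (\<Sum>k<D. P i a k * v j k) * (cnj (v j b) / N j)"
      unfolding P_def[of j] sum_distrib_right by (intro sum.cong) auto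
    then show ?thesis using P_v that by (simp add: P_def)
  qed
  have S_S: "(\<Sum>k<D. S a k * S k b) = S a b" if "a < D" for a b
  proof -
    have "(\<Sum>k<D. S a k * S k b) = (\<Sum>i\<in>J. \<Sum>j\<in>J. \<Sum>k<D. P i a k * P j k b)"
      unfolding S_def sum_product by (subst sum.swap, rule sum.cong[OF refl], rule sum.swap)
    also have "\<dots> = (\<Sum>i\<in>J. \<Sum>j\<in>J. if i = j then P j a b else 0)"
      using P_P that by (intro sum.cong refl) auto
    also have "\<dots> = S a b" using J by (simp add: S_def)
    finally show ?thesis .
  qed
  obtain h where h: "bij_betw h {..<card J} J"
    using ex_bij_betw_nat_finite[OF J] by (auto simp: atLeast0LessThan)
  have sum_h: "(\<Sum>x<card J. g (h x)) = sum g J" for g :: "'a \<Rightarrow> complex"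
    using h by (rule sum.reindex_bij_betw)
  have hJ: "h x \<in> J" if "x < card J" for x using h that by (auto simp: bij_betw_def)
  \<comment> \<open>The outcomes below \<open>card J\<close> project onto the members enumerated by
    \<open>h\<close>. The last one is the complement of their sum and annihilates every
    member.\<close>
  define M where "M x = mat D D (\<lambda>(a, b). if x < card J then P (h x) a b
    else (if a = b then 1 else 0) - S a b)" for x
  have M_carrier: "M x \<in> carrier_mat (party_dim m n p) (party_dim m n p)" for x
    by (simp add: M_def D_def)
  have kraus: "kraus_family (party_dim m n p) (Suc (card J)) M"
  proof (rule kraus_familyI, fold D_def)
    fix a b assume ab: "a < D" "b < D"
    have "(\<Sum>k<D. cnj (M x $$ (k, a)) * M x $$ (k, b)) = P (h x) a b" if "x < card J" for x
      using that ab P_P[OF hJ hJ, of x x a b] by (simp add: M_def cnj_P)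
    then have 1: "(\<Sum>x<card J. \<Sum>k<D. cnj (M x $$ (k, a)) * M x $$ (k, b)) = S a b"
      by (simp add: sum_h[of "\<lambda>j. P j a b"] S_def)
    have cnj_S: "cnj (S k a) = S a k" for k a by (simp add: S_def cnj_P)
    \<comment> \<open>\<open>S\<close> is Hermitian and idempotent, hence so is its
      complement.\<close>
    have "(\<Sum>k<D. cnj (M (card J) $$ (k, a)) * M (card J) $$ (k, b)) =
      (\<Sum>k<D. (if k = a then (if a = b then 1 else 0) - S a b else 0) -
         (if k = b then S a b else 0) + S a k * S k b)"
      using ab by (intro sum.cong) (auto simp: M_def cnj_S algebra_simps)
    also have "\<dots> = (if a = b then 1 else 0) - S a b"
      using ab by (simp add: sum.distrib sum_subtractf S_S)
    finally show "(\<Sum>x<Suc (card J). \<Sum>k<D. cnj (M x $$ (k, a)) * M x $$ (k, b)) = (if a = b then 1 else 0)"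
      using 1 by simp
  qed (simp add: M_def)
  show ?thesis
  proof (rule distinguishable_Measure[OF kraus])
    fix x assume x: "x < Suc (card J)"
    have zero: "local_op m n p (M x) *\<^sub>v f j = 0\<^sub>v (m * n)"
      if j: "j \<in> J" and ne: "\<not> (x < card J \<and> j = h x)" for j
    proof (rule eq_vecI)
      fix i assume "i < dim_vec (0\<^sub>v (m * n) :: complex vec)"
      then have i: "i < m * n" by simp
      let ?a = "own n p i" and ?y = "own n (other p) i"
      have a: "?a < D" and y: "?y < party_dim m n (other p)" unfolding D_def using own_less[OF i] by auto
      have "(local_op m n p (M x) *\<^sub>v f j) $ i = (\<Sum>z<D. M x $$ (?a, z) * f j $ join n p z ?y)"
        unfolding D_def by (rule local_op_index[OF M_carrier f[OF j] i])
      also have "\<dots> = u ?y * (\<Sum>z<D. M x $$ (?a, z) * v j z)"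
        unfolding sum_distrib_left
        by (rule sum.cong) (simp_all add: prod[OF j] own_join[OF _ y] D_def)
      also have "(\<Sum>z<D. M x $$ (?a, z) * v j z) = 0"
      proof (cases "x < card J")
        case True
        then show ?thesis using P_v[OF hJ[OF True] j a] ne a by (simp add: M_def)
      next
        case False
        have "(\<Sum>z<D. S ?a z * v j z) = (\<Sum>k\<in>J. \<Sum>z<D. P k ?a z * v j z)"
          unfolding S_def sum_distrib_right by (rule sum.swap)
        also have "\<dots> = (\<Sum>k\<in>J. if k = j then v j ?a else 0)"
          using P_v[OF _ j a] by (intro sum.cong) auto
        finally have S_v: "(\<Sum>z<D. S ?a z * v j z) = v j ?a" using J j by simp
        have "(\<Sum>z<D. M x $$ (?a, z) * v j z) =
            (\<Sum>z<D. (if z = ?a then v j ?a else 0) - S ?a z * v j z)"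
          using False a by (intro sum.cong) (auto simp: M_def algebra_simps)
        also have "\<dots> = 0" using a by (simp add: sum_subtractf S_v)
        finally show ?thesis .
      qed
      finally show "(local_op m n p (M x) *\<^sub>v f j) $ i = 0\<^sub>v (m * n) $ i" using i by simp
    qed (use carrier_matD(1)[OF local_op_carrier[OF M_carrier]] in simp)
    show "distinguishable m n J (\<lambda>j. local_op m n p (M x) *\<^sub>v f j)"
      by (rule distinguishable_Stop) (metis zero)
  qed
qed

text \<open>Party \<open>p\<close> measures in the Fourier basis; as its index is a function \<open>\<rho>\<close> of the other party's index,
  this only multiplies amplitudes by phases independent of the state.\<close>

lemma distinguishable_orthogonal:
  assumes J: "finite J" and pos: "m > 0" "n > 0"
    and f: "\<And>j. j \<in> J \<Longrightarrow> f j \<in> carrier_vec (m * n)"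
    and supp: "\<And>j i. \<lbrakk>j \<in> J; i < m * n; f j $ i \<noteq> 0\<rbrakk> \<Longrightarrow> own n p i = \<rho> (own n (other p) i)"
    and \<rho>: "\<And>y. y < party_dim m n (other p) \<Longrightarrow> \<rho> y < party_dim m n p"
    and orth: "\<And>j k. \<lbrakk>j \<in> J; k \<in> J; j \<noteq> k\<rbrakk> \<Longrightarrow> f j \<bullet>c f k = 0"
  shows "distinguishable m n J f"
proof -
  define D where "D = party_dim m n p"
  have D: "D > 0" using pos by (cases p) (auto simp: D_def party_dim_def)
  have oo: "other (other p) = p" by (cases p) auto
  have f_join: "f j $ join n p x y = 0"
    if "j \<in> J" "x < D" "y < party_dim m n (other p)" "x \<noteq> \<rho> y" for j x y
    using supp[of j "join n p x y"] own_join[of x m n p y] that unfolding D_def by auto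
  show ?thesis
  proof (rule distinguishable_Measure)
    show "kraus_family (party_dim m n p) D (fourier_kraus D)"
      using kraus_fourier[OF D] by (simp add: D_def)
    fix x assume "x < D"
    have F: "fourier_kraus D x \<in> carrier_mat (party_dim m n p) (party_dim m n p)"
      by (simp add: fourier_kraus_def D_def)
    \<comment> \<open>The factor that the Fourier bra attaches to the amplitude at \<open>y\<close>.
      Its modulus does not depend on \<open>y\<close>, so inner products are only rescaled by
      \<open>1 / D\<close>.\<close>
    define c where "c y = cis (2 * pi * x * \<rho> y / D) / sqrt D" for y
    have c: "c y * cnj (c y) = 1 / D" for y
    proof -
      have "c y * cnj (c y) = of_real ((cmod (c y))\<^sup>2)" by (simp only: complex_norm_square)
      then show ?thesis by (simp add: c_def norm_divide power_divide)
    qed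
    show "distinguishable m n J (\<lambda>j. local_op m n p (fourier_kraus D x) *\<^sub>v f j)"
    \<comment> \<open>Party \<open>p\<close> now sits in basis state 0, which is the common factor;
      the other party holds the phase-shifted amplitudes.\<close>
    proof (rule distinguishable_local[where p = "other p" and u = "\<lambda>a. if a = 0 then 1 else 0"
          and v = "\<lambda>j y. c y * f j $ join n p (\<rho> y) y", OF J, unfolded oo])
      show "local_op m n p (fourier_kraus D x) *\<^sub>v f j \<in> carrier_vec (m * n)" if "j \<in> J" for j
        using local_op_carrier[OF F] f[OF that] by simp
    next
      fix j i assume j: "j \<in> J" and i: "i < m * n"
      let ?y = "own n (other p) i"
      have y: "?y < party_dim m n (other p)" using own_less[OF i] .
      have "(local_op m n p (fourier_kraus D x) *\<^sub>v f j) $ i =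
          (\<Sum>z<D. fourier_kraus D x $$ (own n p i, z) * f j $ join n p z ?y)"
        unfolding D_def[symmetric] local_op_index[OF F f[OF j] i] ..
      also have "\<dots> = (\<Sum>z<D. if z = \<rho> ?y then
          (if own n p i = 0 then 1 else 0) * (c ?y * f j $ join n p (\<rho> ?y) ?y) else 0)"
        using own_less[OF i, of p] f_join[OF j _ y]
        by (intro sum.cong) (auto simp: fourier_kraus_def c_def D_def[symmetric])
      also have "\<dots> = (if own n p i = 0 then 1 else 0) * (c ?y * f j $ join n p (\<rho> ?y) ?y)"
        using \<rho>[OF y] by (simp add: D_def)
      finally show "(local_op m n p (fourier_kraus D x) *\<^sub>v f j) $ i =
          (if own n p i = 0 then 1 else 0) * (c ?y * f j $ join n p (\<rho> ?y) ?y)" .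
    next
      fix j k assume jk: "j \<in> J" "k \<in> J" "j \<noteq> k"
      \<comment> \<open>The support is the graph of \<open>\<rho>\<close>, so the inner product
        collapses to a sum over the other party's index.\<close>
      have "0 = f j \<bullet>c f k" using orth[OF jk] by simp
      also have "\<dots> = (\<Sum>i<m * n. f j $ i * cnj (f k $ i))"
        using f[OF jk(1)] f[OF jk(2)] by (simp add: scalar_prod_def atLeast0LessThan)
      also have "\<dots> = (\<Sum>y<party_dim m n (other p). \<Sum>x<D. f j $ join n p x y * cnj (f k $ join n p x y))"
        unfolding D_def by (rule sum_own)
      also have "\<dots> = (\<Sum>y<party_dim m n (other p). \<Sum>x<D. if x = \<rho> y then
          f j $ join n p (\<rho> y) y * cnj (f k $ join n p (\<rho> y) y) else 0)"
        using f_join[OF jk(1)] by (intro sum.cong refl) auto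
      also have "\<dots> = (\<Sum>y<party_dim m n (other p). f j $ join n p (\<rho> y) y * cnj (f k $ join n p (\<rho> y) y))"
        using \<rho> by (intro sum.cong refl) (simp add: D_def)
      finally have zero: "(\<Sum>y<party_dim m n (other p). f j $ join n p (\<rho> y) y * cnj (f k $ join n p (\<rho> y) y)) = 0"
        by simp
      have "(\<Sum>y<party_dim m n (other p). c y * f j $ join n p (\<rho> y) y * cnj (c y * f k $ join n p (\<rho> y) y)) =
          (\<Sum>y<party_dim m n (other p). (c y * cnj (c y)) *
            (f j $ join n p (\<rho> y) y * cnj (f k $ join n p (\<rho> y) y)))"
        by (intro sum.cong refl) (simp add: mult_ac)
      also have "\<dots> = 0" unfolding c sum_distrib_left[symmetric] zero by simp
      finally show "(\<Sum>y<party_dim m n (other p). c y * f j $ join n p (\<rho> y) y *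
          cnj (c y * f k $ join n p (\<rho> y) y)) = 0" .
    qed
  qed
qed


section \<open>Peeling off the tiles\<close>

text \<open>With \<open>a\<close> and \<open>b\<close> both in the basis state selected by Bob's column, Alice can tell columns with
  different \<open>\<tau>\<close> apart although she does not hold \<open>B\<close>.\<close>

definition embed :: "nat \<Rightarrow> nat \<Rightarrow> (nat \<Rightarrow> nat) \<Rightarrow> (nat \<times> nat) set \<Rightarrow> complex vec \<Rightarrow> complex vec" where
  "embed q d \<tau> Y \<phi> = vec ((q * d) * (q * d)) (\<lambda>i.
     let r = i div (q * d); c = i mod (q * d)
     in if r div d = \<tau> (c mod d) \<and> c div d = \<tau> (c mod d) \<and> (r mod d, c mod d) \<in> Y
        then \<phi> $ (r mod d * d + c mod d) else 0)"

lemma embed_carrier: "embed q d \<tau> Y \<phi> \<in> carrier_vec ((q * d) * (q * d))"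
  by (simp add: embed_def)

lemma pair_index_div_mod:
  fixes i j n :: nat
  assumes "j < n" shows "(i * n + j) div n = i" "(i * n + j) mod n = j"
  using assms by auto

text \<open>The column determines both registers, so distinct cells go to distinct basis vectors and
  the embedding preserves inner products of the restrictions to \<open>Y\<close>.\<close>

lemma cscalar_prod_embed:
  assumes \<tau>: "\<And>j. j < d \<Longrightarrow> \<tau> j < q"
  shows "embed q d \<tau> Y \<phi> \<bullet>c embed q d \<tau> Y \<chi> =
    (\<Sum>i<d. \<Sum>j<d. if (i, j) \<in> Y then \<phi> $ (i * d + j) * cnj (\<chi> $ (i * d + j)) else 0)"
proof -
  let ?N = "q * d"
  \<comment> \<open>Position of cell \<open>(i, j)\<close> when both registers hold
    \<open>\<tau> j\<close>; every other position carries amplitude 0.\<close>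
  let ?f = "\<lambda>(i, j). (\<tau> j * d + i) * ?N + (\<tau> j * d + j)"
  let ?D = "{..<d} \<times> {..<d}"
  let ?g = "\<lambda>k. embed q d \<tau> Y \<phi> $ k * cnj (embed q d \<tau> Y \<chi> $ k)"
  have less: "\<tau> j * d + i < ?N" if "i < d" "j < d" for i j
    using \<tau> that by (simp add: pair_index_less)
  have dm: "?f (i, j) < ?N * ?N" "?f (i, j) div ?N = \<tau> j * d + i" "?f (i, j) mod ?N = \<tau> j * d + j"
    "(\<tau> j * d + i) div d = \<tau> j" "(\<tau> j * d + i) mod d = i"
    if "i < d" "j < d" for i j
    unfolding prod.case
    using pair_index_less[OF less[OF that] less[OF that(2,2)]] that
      pair_index_div_mod[OF less[OF that(2,2)], of "\<tau> j * d + i"] pair_index_div_mod[OF that(1), of "\<tau> j"]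
    by blast+
  have "embed q d \<tau> Y \<phi> \<bullet>c embed q d \<tau> Y \<chi> = (\<Sum>k<?N * ?N. ?g k)"
    by (simp add: scalar_prod_def atLeast0LessThan embed_def)
  also have "\<dots> = (\<Sum>k\<in>?f ` ?D. ?g k)"
  proof (rule sum.mono_neutral_right)
    show "?f ` ?D \<subseteq> {..<?N * ?N}" using dm by auto
    show "\<forall>k\<in>{..<?N * ?N} - ?f ` ?D. ?g k = 0"
    proof
      fix k assume k: "k \<in> {..<?N * ?N} - ?f ` ?D"
      let ?r = "k div ?N" and ?c = "k mod ?N"
      have kN: "k < ?N * ?N" using k by simp
      have "?r < ?N" "?c < ?N" using mod_div_less[OF kN] by auto
      then have m: "?r mod d < d" "?c mod d < d" by (auto dest: mod_div_less)
      have "\<not> (?r div d = \<tau> (?c mod d) \<and> ?c div d = \<tau> (?c mod d))"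
      proof
        assume e: "?r div d = \<tau> (?c mod d) \<and> ?c div d = \<tau> (?c mod d)"
        have "?f (?r mod d, ?c mod d) = (?r div d * d + ?r mod d) * ?N + (?c div d * d + ?c mod d)"
          unfolding prod.case conjunct1[OF e] conjunct2[OF e] ..
        also have "\<dots> = k" by (simp only: div_mult_mod_eq)
        finally have "k = ?f (?r mod d, ?c mod d)" by (rule sym)
        moreover have "(?r mod d, ?c mod d) \<in> ?D" using m by simp
        ultimately have "k \<in> ?f ` ?D" by (rule image_eqI)
        then show False using k by blast
      qed
      then show "?g k = 0" using kN by (auto simp: embed_def Let_def)
    qed
  qed simp
  also have "\<dots> = (\<Sum>x\<in>?D. ?g (?f x))"
  proof (rule sum.reindex_cong[where l = ?f])
    show "inj_on ?f ?D"
    proof (rule inj_onI)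
      fix x y assume xy: "x \<in> ?D" "y \<in> ?D" "?f x = ?f y"
      obtain i j i' j' where e: "x = (i, j)" "y = (i', j')" by (metis surj_pair)
      have l: "i < d" "j < d" "i' < d" "j' < d" using xy(1,2) e by auto
      show "x = y" using xy(3) dm[OF l(1,2)] dm[OF l(3,4)] dm(5)[OF l(2,2)] dm(5)[OF l(4,4)]
        unfolding e by (metis (no_types, lifting))
    qed
  qed auto
  also have "\<dots> = (\<Sum>(i, j)\<in>?D. if (i, j) \<in> Y then \<phi> $ (i * d + j) * cnj (\<chi> $ (i * d + j)) else 0)"
  proof (rule sum.cong[OF refl])
    fix x assume "x \<in> ?D"
    then obtain i j where x: "x = (i, j)" and l: "i < d" "j < d" by auto
    note dm = dm[OF l] dm(4,5)[OF l(2,2)]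
    have "embed q d \<tau> Y \<psi> $ ?f (i, j) = (if (i, j) \<in> Y then \<psi> $ (i * d + j) else 0)" for \<psi>
      unfolding embed_def Let_def index_vec[OF dm(1)] dm(2-) by simp
    then show "?g (?f x) =
        (case x of (i, j) \<Rightarrow> if (i, j) \<in> Y then \<phi> $ (i * d + j) * cnj (\<chi> $ (i * d + j)) else 0)"
      unfolding x by (simp only: prod.case) simp
  qed
  also have "\<dots> = (\<Sum>i<d. \<Sum>j<d. if (i, j) \<in> Y then \<phi> $ (i * d + j) * cnj (\<chi> $ (i * d + j)) else 0)"
    by (simp add: sum.cartesian_product)
  finally show ?thesis .
qed

section \<open>Local measurements as operations on sets of cells\<close>

definition embed_distinguishable ::
    "nat \<Rightarrow> nat \<Rightarrow> (nat \<Rightarrow> nat) \<Rightarrow> complex vec set \<Rightarrow> (nat \<times> nat) set \<Rightarrow> bool" where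
  "embed_distinguishable q d \<tau> S Y \<longleftrightarrow> distinguishable (q * d) (q * d) S (embed q d \<tau> Y)"

text \<open>On the support both registers hold \<open>\<tau> j\<close>, so a test on registers and
  coordinates is a test on cells and merely shrinks \<open>Y\<close>.\<close>

lemma embed_restrict:
  assumes "d > 0"
    and "\<And>i j. \<lbrakk>i < d; j < d\<rbrakk> \<Longrightarrow> (i, j) \<in> Z \<longleftrightarrow> (i, j) \<in> Y \<and> C (\<tau> j) i (\<tau> j) j"
    and "\<And>i. i < (q * d) * (q * d) \<Longrightarrow>
      b i \<longleftrightarrow> C (i div (q * d) div d) (i div (q * d) mod d) (i mod (q * d) div d) (i mod (q * d) mod d)"
  shows "vec ((q * d) * (q * d)) (\<lambda>i. if b i then embed q d \<tau> Y \<phi> $ i else 0) = embed q d \<tau> Z \<phi>"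
  using assms by (intro eq_vecI) (auto simp: embed_def Let_def)

text \<open>A two-outcome projective measurement by \<open>p\<close>, who sees the register and one
  coordinate. For Alice this means the row and the label of the column.\<close>

lemma embed_distinguishable_split:
  assumes Y: "embed_distinguishable q d \<tau> S Y1" "embed_distinguishable q d \<tau> S Y2" and d: "d > 0"
    and split: "\<And>i j. \<lbrakk>i < d; j < d\<rbrakk> \<Longrightarrow> (i, j) \<in> Y1 \<longleftrightarrow> (i, j) \<in> Y \<and> C (\<tau> j) (case p of Alice \<Rightarrow> i | Bob \<Rightarrow> j)"
      "\<And>i j. \<lbrakk>i < d; j < d\<rbrakk> \<Longrightarrow> (i, j) \<in> Y2 \<longleftrightarrow> (i, j) \<in> Y \<and> \<not> C (\<tau> j) (case p of Alice \<Rightarrow> i | Bob \<Rightarrow> j)"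
  shows "embed_distinguishable q d \<tau> S Y"
proof -
  let ?N = "q * d"
  define l :: "nat \<Rightarrow> nat" where "l i = (if C (i div d) (i mod d) then 0 else 1)" for i
  have e: "vec (?N * ?N) (\<lambda>i. if l (own ?N p i) = 0 then embed q d \<tau> Y \<phi> $ i else 0) = embed q d \<tau> Y1 \<phi>"
    "vec (?N * ?N) (\<lambda>i. if l (own ?N p i) = 1 then embed q d \<tau> Y \<phi> $ i else 0) = embed q d \<tau> Y2 \<phi>" for \<phi>
    by (rule embed_restrict[OF d, where C = "\<lambda>a i b j. case p of Alice \<Rightarrow> C a i | Bob \<Rightarrow> C b j"];
        simp add: split l_def own_def split: party.split)
      (rule embed_restrict[OF d, where C = "\<lambda>a i b j. case p of Alice \<Rightarrow> \<not> C a i | Bob \<Rightarrow> \<not> C b j"];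
        simp add: split l_def own_def split: party.split)
  show ?thesis unfolding embed_distinguishable_def
  proof (rule distinguishable_sort[where l = l and r = 2 and p = p])
    fix x :: nat assume "x < 2"
    then consider "x = 0" | "x = 1" by linarith
    then show "distinguishable ?N ?N S (\<lambda>\<phi>. vec (?N * ?N)
        (\<lambda>i. if l (own ?N p i) = x then embed q d \<tau> Y \<phi> $ i else 0))"
      using Y unfolding embed_distinguishable_def by cases (simp_all only: e)
  qed (auto simp: embed_carrier l_def)
qed

text \<open>Once the coordinate of \<open>p\<close> is fixed at \<open>k\<close>, only the register
  of \<open>p\<close> varies, and it agrees with the other register. The index of \<open>p\<close>
  is thus a function of the other party's index.\<close>

lemma embed_distinguishable_orthogonal:
  assumes S: "finite S" and d: "d > 0" and q: "q > 0" and \<tau>: "\<And>j. j < d \<Longrightarrow> \<tau> j < q"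
    and k: "k < d" and Y: "\<And>i j. (i, j) \<in> Y \<Longrightarrow> (case p of Alice \<Rightarrow> i | Bob \<Rightarrow> j) = k"
    and orth: "\<And>\<phi> \<chi>. \<lbrakk>\<phi> \<in> S; \<chi> \<in> S; \<phi> \<noteq> \<chi>\<rbrakk> \<Longrightarrow>
      (\<Sum>i<d. \<Sum>j<d. if (i, j) \<in> Y then \<phi> $ (i * d + j) * cnj (\<chi> $ (i * d + j)) else 0) = 0"
  shows "embed_distinguishable q d \<tau> S Y"
  unfolding embed_distinguishable_def
proof (rule distinguishable_orthogonal[where p = p and \<rho> = "\<lambda>y. y div d * d + k"])
  fix \<phi> i assume i: "i < q * d * (q * d)" "embed q d \<tau> Y \<phi> $ i \<noteq> 0"
  let ?r = "i div (q * d)" and ?c = "i mod (q * d)"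
  have "?r div d = ?c div d" "(?r mod d, ?c mod d) \<in> Y"
    using i by (auto simp: embed_def Let_def split: if_splits)
  then show "own (q * d) p i = own (q * d) (other p) i div d * d + k"
    using Y[of "?r mod d" "?c mod d"] div_mult_mod_eq[of ?r d] div_mult_mod_eq[of ?c d]
    by (cases p) (simp_all add: own_def)
next
  fix y assume "y < party_dim (q * d) (q * d) (other p)"
  then have "y < q * d" by (cases p) (auto simp: party_dim_def)
  then have "y div d * d + k < q * d" using k by (intro pair_index_less mod_div_less)
  then show "y div d * d + k < party_dim (q * d) (q * d) p" by (cases p) (auto simp: party_dim_def)
qed (use S d q orth in \<open>auto simp: embed_carrier cscalar_prod_embed[OF \<tau>]\<close>)


section \<open>The tiling\<close>

text \<open>The common support of the states \<open>tile_state d (t, k, c)\<close>: the top, right,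
  bottom and left edges of ring \<open>t\<close>, arranged as a pinwheel so that each corner lies in
  exactly one of them.\<close>

definition tile :: "nat \<Rightarrow> nat \<Rightarrow> nat \<Rightarrow> (nat \<times> nat) set" where
  "tile d t c = (if c = 0 then {t} \<times> {t..d - 2 - t}
     else if c = 1 then {t..d - 2 - t} \<times> {d - 1 - t}
     else if c = 2 then {d - 1 - t} \<times> {t + 1..d - 1 - t}
     else {t + 1..d - 1 - t} \<times> {t})"

lemma tile_state_outside:
  assumes "2 * t + 3 \<le> d" "i < d" "j < d" "(i, j) \<notin> tile d t c"
  shows "tile_state d (t, k, c) $ (i * d + j) = 0"
proof -
  have "tile_state d (t, k, c) $ (i * d + j) = row_part d (t, k, c) $ i * col_part d (t, k, c) $ j"
    using index_tensor_vec[of i "row_part d (t, k, c)" j "col_part d (t, k, c)"] assms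
    by (simp add: tile_state_def)
  moreover have "row_part d (t, k, c) $ i = 0 \<or> col_part d (t, k, c) $ j = 0"
  proof -
    consider "c = 0" | "c = 1" | "c = 2" | "c \<noteq> 0 \<and> c \<noteq> 1 \<and> c \<noteq> 2" by blast
    then show ?thesis
      using assms(2-4) assms(1) by cases (simp_all add: tile_def row_part_def col_part_def fourier_index, blast+)
  qed
  ultimately show ?thesis by auto
qed

lemma tile_unique:
  assumes "2 * t + 3 \<le> d" "2 * t' + 3 \<le> d" "c < 4" "c' < 4" "x \<in> tile d t c" "x \<in> tile d t' c'"
  shows "t = t' \<and> c = c'"
proof -
  obtain i j where x: "x = (i, j)" by fastforce
  have "c \<in> {0, 1, 2, 3}" "c' \<in> {0, 1, 2, 3}" using assms by auto
  then show ?thesis using assms unfolding x tile_def by (elim insertE emptyE) auto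
qed

text \<open>A cell of ring \<open>t\<close> has a coordinate \<open>t\<close> or
  \<open>d - 1 - t\<close>, and these lie strictly on either side of \<open>n + 1\<close>. Hence
  only the stopper is nonzero at the center.\<close>

lemma tile_center:
  assumes "d = 2 * n + 3" "2 * t + 3 \<le> d"
  shows "(n + 1, n + 1) \<notin> tile d t c"
proof
  assume "(n + 1, n + 1) \<in> tile d t c"
  then have "n + 1 = t \<or> n + 1 = d - 1 - t"
    unfolding tile_def by (simp only: mem_Sigma_iff singleton_iff split: if_splits) blast+
  with assms show False by arith
qed

lemma finite_U_states: "finite (U_states d)"
  unfolding U_states_eq by (simp add: index_set_def)

text \<open>Restricting the states to a union of tiles keeps or kills every state but the stopper.\<close>

lemma U_states_orthogonal_on:
  assumes d: "d \<ge> 3" and \<phi>: "\<phi> \<in> U_states d" and \<chi>: "\<chi> \<in> U_states d" and ne: "\<phi> \<noteq> \<chi>"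
    and Y: "\<And>t c. \<lbrakk>2 * t + 3 \<le> d; c < 4\<rbrakk> \<Longrightarrow> tile d t c \<subseteq> Y \<or> tile d t c \<inter> Y = {}"
  shows "(\<Sum>i<d. \<Sum>j<d. if (i, j) \<in> Y then \<phi> $ (i * d + j) * cnj (\<chi> $ (i * d + j)) else 0) = 0"
proof -
  define B where "B \<phi> \<chi> i j =
      (if (i, j) \<in> Y then \<phi> $ (i * d + j) * cnj (\<chi> $ (i * d + j)) else 0)" for \<phi> \<chi> i j
  have *: "(\<Sum>i<d. \<Sum>j<d. B \<phi> \<chi> i j) = 0"
    if U: "\<phi> \<in> U_states d" "\<chi> \<in> U_states d" "\<phi> \<noteq> \<chi>" and ns: "\<phi> \<noteq> stopper d" for \<phi> \<chi>
  proof -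
    obtain t k c where x: "(t, k, c) \<in> index_set d" and \<phi>: "\<phi> = tile_state d (t, k, c)"
      using U(1) ns unfolding U_states_eq by auto
    have t: "2 * t + 3 \<le> d" "c < 4" using x d by (auto simp: index_set_def)
    show ?thesis using Y[OF t]
    proof
      \<comment> \<open>The whole support of \<open>\<phi>\<close> is kept, so the restricted inner
        product is the full one.\<close>
      assume sub: "tile d t c \<subseteq> Y"
      have "\<phi> \<bullet>c \<chi> = (\<Sum>k = 0..<d * d. \<phi> $ (k div d * d + k mod d) * cnj (\<chi> $ (k div d * d + k mod d)))"
        using U(1,2) U_states_carrier[of d] by (auto simp: scalar_prod_def intro!: sum.cong)
      also have "\<dots> = (\<Sum>i<d. \<Sum>j<d. \<phi> $ (i * d + j) * cnj (\<chi> $ (i * d + j)))"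
        unfolding sum_div_mod[where f = "\<lambda>i j. \<phi> $ (i * d + j) * cnj (\<chi> $ (i * d + j))"]
        by (simp add: atLeast0LessThan)
      also have "\<dots> = (\<Sum>i<d. \<Sum>j<d. B \<phi> \<chi> i j)"
        using sub tile_state_outside[OF t(1), of _ _ c k] unfolding \<phi> B_def
        by (intro sum.cong refl) auto
      finally show ?thesis using U_states_orthogonal[OF d U] by simp
    next
      assume "tile d t c \<inter> Y = {}"
      then show ?thesis using tile_state_outside[OF t(1), of _ _ c k] unfolding \<phi> B_def
        by (intro sum.neutral ballI) auto
    qed
  qed
  show ?thesis
  proof (cases "\<phi> = stopper d")
    case True
    \<comment> \<open>The stopper is not confined to a tile; conjugate symmetry moves it to the
      second argument.\<close>
    have "(\<Sum>i<d. \<Sum>j<d. B \<phi> \<chi> i j) = cnj (\<Sum>i<d. \<Sum>j<d. B \<chi> \<phi> i j)"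
      unfolding cnj_sum by (intro sum.cong refl) (simp add: B_def)
    also have "\<dots> = 0" using *[OF \<chi> \<phi>] ne True by simp
    finally show ?thesis by (simp add: B_def)
  next
    case False
    then show ?thesis using *[OF \<phi> \<chi> ne] by (simp add: B_def)
  qed
qed

section \<open>Discrimination on single tiles and on concentric squares\<close>

text \<open>Even \<open>c\<close> gives a horizontal tile, on which Alice's row is constant; odd
  \<open>c\<close> gives a vertical one, on which Bob's column is constant.\<close>

lemma embed_distinguishable_tile:
  assumes d: "d \<ge> 3" and q: "q > 0" and \<tau>: "\<And>j. j < d \<Longrightarrow> \<tau> j < q"
    and t: "2 * t + 3 \<le> d" "c < 4"
  shows "embed_distinguishable q d \<tau> (U_states d) (tile d t c)"
proof (rule embed_distinguishable_orthogonal[OF finite_U_states, where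
      p = "if even c then Alice else Bob" and k = "if c = 0 \<or> c = 3 then t else d - 1 - t"])
  fix i j assume "(i, j) \<in> tile d t c"
  moreover have "c \<in> {0, 1, 2, 3}" using t by auto
  ultimately show "(case if even c then Alice else Bob of Alice \<Rightarrow> i | Bob \<Rightarrow> j) =
      (if c = 0 \<or> c = 3 then t else d - 1 - t)"
    by (elim insertE emptyE) (auto simp: tile_def)
next
  fix \<phi> \<chi> assume "\<phi> \<in> U_states d" "\<chi> \<in> U_states d" "\<phi> \<noteq> \<chi>"
  then show "(\<Sum>i<d. \<Sum>j<d. if (i, j) \<in> tile d t c
      then \<phi> $ (i * d + j) * cnj (\<chi> $ (i * d + j)) else 0) = 0"
  proof (rule U_states_orthogonal_on[OF d])
    fix t' c' assume "2 * t' + 3 \<le> d" "c' < (4 :: nat)"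
    then show "tile d t' c' \<subseteq> tile d t c \<or> tile d t' c' \<inter> tile d t c = {}"
      using tile_unique[OF t(1) _ t(2)] by blast
  qed
qed (use d q \<tau> t in auto)

text \<open>Induction from the center outwards, each step adding the four tiles of one ring. By
  \<open>sep\<close>, every column right of the middle is identified by its label.\<close>

lemma embed_distinguishable_square:
  assumes d: "d = 2 * n + 3" and q: "q > 0" and \<tau>: "\<And>j. j < d \<Longrightarrow> \<tau> j < q"
    and sep: "\<And>j k. \<lbrakk>n + 1 < k; k < d; j < d; \<tau> j = \<tau> k\<rbrakk> \<Longrightarrow> j = k"
    and t: "t \<le> n + 1"
  shows "embed_distinguishable q d \<tau> (U_states d) ({t..d - 1 - t} \<times> {t..d - 1 - t})"
  using t
proof (induction rule: inc_induct)
  case base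
  \<comment> \<open>The innermost square is the central cell, which meets no tile.\<close>
  have sq: "{n + 1..d - 1 - (n + 1)} \<times> {n + 1..d - 1 - (n + 1)} = {(n + 1, n + 1)}"
    using d by auto
  show ?case unfolding sq
  proof (rule embed_distinguishable_orthogonal[OF finite_U_states, where p = Alice and k = "n + 1"])
    fix \<phi> \<chi> assume "\<phi> \<in> U_states d" "\<chi> \<in> U_states d" "\<phi> \<noteq> \<chi>"
    then show "(\<Sum>i<d. \<Sum>j<d. if (i, j) \<in> {(n + 1, n + 1)}
        then \<phi> $ (i * d + j) * cnj (\<chi> $ (i * d + j)) else 0) = 0"
      by (rule U_states_orthogonal_on[rotated]) (use d tile_center[OF d] in auto)
  qed (use d q \<tau> in auto)
next
  case (step t)
  let ?E = "embed_distinguishable q d \<tau> (U_states d)"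
  have t: "2 * t + 3 \<le> d" and d3: "d \<ge> 3" and d0: "d > 0" using step.hyps d by auto
  have tile: "?E (tile d t c)" if "c < 4" for c
    using embed_distinguishable_tile[OF d3 q \<tau> t that] .
  let ?e = "d - 1 - t" and ?I = "{t + 1..d - 2 - t}"
  \<comment> \<open>The last column of the ring lies right of the middle, so Alice's register
    reveals whether Bob is in it.\<close>
  have \<tau>_last: "\<tau> j = \<tau> ?e \<longleftrightarrow> j = ?e" if "j < d" for j
    using sep[of ?e j] that step.hyps d by auto
  have inner: "?E (?I \<times> ?I)"
    using step.IH by (simp add: diff_diff_left numeral_2_eq_2)
  \<comment> \<open>The splits are composed in reverse order: this one is performed last, when only
    the bottom tile remains around the inner square.\<close>
  have "?E (?I \<times> ?I \<union> tile d t 2)"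
    by (rule embed_distinguishable_split[OF tile[of 2] inner d0, where p = Alice
          and C = "\<lambda>a i. i = ?e"])
      (use t in \<open>auto simp: tile_def\<close>)
  \<comment> \<open>The top left corner went with the top tile, so Bob's column \<open>t\<close>
    contains just the left tile.\<close>
  then have "?E (?I \<times> ?I \<union> tile d t 2 \<union> tile d t 3)"
    by (rule embed_distinguishable_split[OF tile[of 3] _ d0, where p = Bob
          and C = "\<lambda>b j. j = t", rotated])
      (use t in \<open>auto simp: tile_def\<close>)
  \<comment> \<open>The row test spares the bottom right corner, which belongs to the bottom
    tile.\<close>
  then have "?E (?I \<times> ?I \<union> tile d t 2 \<union> tile d t 3 \<union> tile d t 1)"
    by (rule embed_distinguishable_split[OF tile[of 1] _ d0, where p = Alice
          and C = "\<lambda>a i. a = \<tau> ?e \<and> i < ?e", rotated])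
      (use t in \<open>auto simp: tile_def \<tau>_last[simplified]\<close>)
  \<comment> \<open>The label test spares the top right corner, which belongs to the right
    tile.\<close>
  then show ?case
    by (rule embed_distinguishable_split[OF tile[of 0] _ d0, where p = Alice
          and C = "\<lambda>a i. a \<noteq> \<tau> ?e \<and> i = t", rotated])
      (use t in \<open>auto simp: tile_def \<tau>_last[simplified]\<close>)
qed

theorem theorem3:
  fixes d :: nat
  assumes "d \<ge> 3" and "odd d"
  shows "LOCC_distinguishable_with ((d + 1) div 2) d (max_entangled ((d + 1) div 2)) (U_states d)"
proof (rule LOCC_distinguishable_withI)
  define n where "n = (d - 3) div 2"
  have d: "d = 2 * n + 3" unfolding n_def using assms by presburger
  define q where "q = n + 2"
  have q: "(d + 1) div 2 = q" "q > 0" by (auto simp: d q_def)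
  let ?N = "q * d"
  \<comment> \<open>Truncated subtraction: the columns up to the middle one share the label 0.\<close>
  define \<sigma> where "\<sigma> j = j - (n + 1)" for j :: nat
  have \<sigma>: "\<sigma> j < q" if "j < d" for j using that by (simp add: \<sigma>_def q_def d)
  \<comment> \<open>Bob's register minus his column label modulo \<open>q\<close>; adding
    \<open>q\<close> first keeps the natural subtraction exact. The outcome reveals only this shift,
    not the column.\<close>
  define l where "l c = (c div d + (q - \<sigma> (c mod d))) mod q" for c
  have l_iff: "l c = s \<longleftrightarrow> c div d = (\<sigma> (c mod d) + s) mod q" if c: "c < ?N" and s: "s < q" for c s
  proof -
    have b: "c div d < q" "\<sigma> (c mod d) < q" using c \<sigma> mod_div_less[OF c] by auto
    have "(b + (q - x)) mod q = s \<longleftrightarrow> b = (x + s) mod q" if "b < q" "x < q" for b x :: nat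
      using that s by (auto simp: mod_if)
    then show ?thesis using b by (simp add: l_def)
  qed
  show "distinguishable ((d + 1) div 2 * d) ((d + 1) div 2 * d) (U_states d)
      (\<lambda>\<phi>. assisted ((d + 1) div 2) d \<phi> (max_entangled ((d + 1) div 2)))"
    unfolding q(1)
  proof (rule distinguishable_sort[where p = Bob and l = l and r = q])
    fix s assume s: "s < q"
    \<comment> \<open>Given outcome \<open>s\<close>, Bob's register must hold the shifted label,
      and the entanglement puts the same value into Alice's.\<close>
    define \<tau> where "\<tau> j = (\<sigma> j + s) mod q" for j
    have "embed_distinguishable q d \<tau> (U_states d) ({0..d - 1 - 0} \<times> {0..d - 1 - 0})"
    proof (rule embed_distinguishable_square[OF d q(2)])
      show "\<tau> j < q" for j using q by (simp add: \<tau>_def)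
      show "j = k" if "n + 1 < k" "k < d" "j < d" "\<tau> j = \<tau> k" for j k
      proof -
        \<comment> \<open>A cyclic shift is injective on labels below \<open>q\<close>; beyond the
          middle column the label is positive and therefore determines the column.\<close>
        have "\<sigma> j = \<sigma> k" using that(4) s \<sigma>[OF that(2)] \<sigma>[OF that(3)]
          by (auto simp: \<tau>_def mod_if split: if_splits)
        then show ?thesis using that(1) by (simp add: \<sigma>_def)
      qed
    qed simp
    then show "distinguishable ?N ?N (U_states d) (\<lambda>\<phi>. vec (?N * ?N)
        (\<lambda>i. if l (own ?N Bob i) = s then assisted q d \<phi> (max_entangled q) $ i else 0))"
      unfolding embed_distinguishable_def
    proof (rule distinguishable_cong)
      fix \<phi>
      show "vec (?N * ?N) (\<lambda>i. if l (own ?N Bob i) = s then assisted q d \<phi> (max_entangled q) $ i else 0) =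
          embed q d \<tau> ({0..d - 1 - 0} \<times> {0..d - 1 - 0}) \<phi>"
      proof (rule eq_vecI)
        fix i assume "i < dim_vec (embed q d \<tau> ({0..d - 1 - 0} \<times> {0..d - 1 - 0}) \<phi>)"
        then have i: "i < ?N * ?N" by (simp add: embed_def)
        let ?r = "i div ?N" and ?c = "i mod ?N"
        have rc: "?r < ?N" "?c < ?N" using mod_div_less[OF i] by auto
        note r = mod_div_less[OF rc(1)] and c = mod_div_less[OF rc(2)]
        \<comment> \<open>The entangled state contributes exactly the condition that both registers
          agree, as \<open>embed\<close> requires.\<close>
        have "max_entangled q $ (?r div d * q + ?c div d) = (if ?r div d = ?c div d then 1 else 0)"
          using pair_index_less[OF r(1) c(1)] pair_index_div_mod[OF c(1), of "?r div d"]
          by (simp add: max_entangled_def)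
        moreover have "?r mod d \<le> d - 1" "?c mod d \<le> d - 1"
          using r(2) c(2) by linarith+
        ultimately show "vec (?N * ?N)
            (\<lambda>i. if l (own ?N Bob i) = s then assisted q d \<phi> (max_entangled q) $ i else 0) $ i =
            embed q d \<tau> ({0..d - 1 - 0} \<times> {0..d - 1 - 0}) \<phi> $ i"
          using i l_iff[OF rc(2) s] by (auto simp: own_def assisted_def embed_def Let_def \<tau>_def)
      qed (simp add: embed_def)
    qed
  next
    show "l i < q" for i using q by (simp add: l_def)
  qed (simp add: assisted_def)
qed

end
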